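(* If $\pmb{p}=(p_1,p_2)=(0,0)$, then for every LR-mesh $\mathcal{M}$ the elements of $\mathcal{B}^{\mathcal{MS}}(\mathcal{M})$ are linearly independent and the elements of $\mathcal{B}^{\mathcal{LR}}(\mathcal{M})$ are linearly independent.
   Context: Meshes. Let $\Omega\subset\mathbb{R}^2$ be an axis-aligned rectangle. A box-partition $\mathcal{E}$ of $\Omega$ is a finite collection of axis-aligned rectangles (elements) with pairwise disjoint interiors and union $\Omega$. Its vertices are the vertices of its elements; a meshline is a segment (in the element boundaries) connecting two and only two vertices of $\mathcal{E}$; the collection $\mathcal{M}$ of meshlines is the box-mesh. Vertical meshlines are called 1-meshlines, horizontal ones 2-meshlines. Each meshline $\gamma$ carries an integer multiplicity $\mu(\gamma)\ge1$; for the fixed bidegree $\pmb{p}=(p_1,p_2)$ one assumes $\mu(\gamma)\le p_k+1$ for every $k$-meshline. An axis-aligned segment $\gamma$ traverses an element $\beta$ if $\beta\setminus\gamma$ is not connected. A split is a finite union of contiguous colinear segments, each of which either traverses an element or is a meshline of $\mathcal{M}$; vertical splits are 1-splits, horizontal splits are 2-splits. A split of $\mathcal{M}$ is a split made of meshlines of $\mathcal{M}$; it is maximal if it contains every meshline of $\mathcal{M}$ contiguous and colinear with it. $\mathcal{M}$ has constant splits if all meshlines in each maximal split have the same multiplicity; this defines $\mu(\gamma)$ for a split $\gamma$ of $\mathcal{M}$. Inserting a split $\gamma$ with multiplicity $\mu_\gamma\ge1$ gives $\mathcal{M}+\gamma$: each element traversed by $\gamma$ is cut in two along $\gamma$; meshlines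 not in $\gamma$ keep their multiplicity, meshlines in $\gamma$ already in $\mathcal{M}$ have multiplicity increased by $\mu_\gamma$, and new meshlines in $\gamma$ get multiplicity $\mu_\gamma$. The length of a $k$-split is the number of orthogonal meshlines it intersects, counted with multiplicity (i.e. the sum, over the mesh vertices on it, of the maximal multiplicity of the orthogonal meshlines at that vertex). LR-mesh: a mesh $\mathcal{M}=\mathcal{M}_N$ obtained from a tensor product mesh $\mathcal{M}_1$ (the mesh of the elements $[\tau_{1,i},\tau_{1,i+1}]\times[\tau_{2,j},\tau_{2,j+1}]$ for two increasing sequences, with multiplicities and constant splits) by successive insertions $\mathcal{M}_{i+1}=\mathcal{M}_i+\gamma_i$, each $\mathcal{M}_{i+1}$ having constant splits. Standing assumptions: $\mathcal{M}_1$ has at least $p_1+2$ vertical and $p_2+2$ horizontal splits counted with multiplicity (LR-rule 1), and at every step every maximal $k$-split has length at least $p_{3-k}+2$, $k\in\{1,2\}$ (LR-rule 2). B-splines. For nondecreasing $\pmb{t}=(t_1,\dots,t_{p+2})$, $B[\pmb{t}]$ is the univariate degree $p$ B-spline given by $B[\pmb{t}](t)=\frac{t-t_1}{t_{p+1}-t_1}B[t_1,\dots,t_{p+1}](t)+\frac{t_{p+2}-t}{t_{p+2}-t_2}B[t_2,\dots,t_{p+2}](t)$ (fractions with zero denominator are $0$), with $B[t_i,t_{i+1}]$ the indicator of $[t_i,t_{i+1})$. For $\pmb{x}=(x_1,\dots,x_{p_1+2})$, $\pmb{y}=(y_1,\dots,y_{p_2+2})$, $B[\pmb{x},\pmb{y}](x,y)=B[\pmb{x}](x)B[\pmb{y}](y)$,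 with support $[x_1,x_{p_1+2}]\times[y_1,y_{p_2+2}]$. The splits of $B[\pmb{x},\pmb{y}]$ are the segments $\{x_i\}\times[y_1,y_{p_2+2}]$ and $[x_1,x_{p_1+2}]\times\{y_j\}$, with multiplicity that of $x_i$ in $\pmb{x}$, resp. $y_j$ in $\pmb{y}$. A split $\gamma$ traverses $B[\pmb{x},\pmb{y}]$ if it divides the interior of the support into two parts. MS B-splines. $B[\pmb{x},\pmb{y}]$ has support in $\mathcal{M}$ if its support lies in $\Omega$ and every split of it of multiplicity $m$ is contained in a split $\gamma$ of $\mathcal{M}$ with $\mu(\gamma)\ge m$. It has minimal support in $\mathcal{M}$ (is an MS B-spline) if in addition, for every split $\gamma$ of $\mathcal{M}$ meeting the interior of its support, $\gamma$ traverses $B[\pmb{x},\pmb{y}]$ if and only if a split of $B[\pmb{x},\pmb{y}]$ of multiplicity $\mu(\gamma)$ is contained in $\gamma$. $\mathcal{B}^{\mathcal{MS}}(\mathcal{M})$ is the set of all MS B-splines of bidegree $\pmb{p}$ on $\mathcal{M}$. LR B-splines. Given the construction sequence $\mathcal{M}_1,\dots,\mathcal{M}_N=\mathcal{M}$, let $\mathcal{B}_1$ be the set of tensor product B-splines of bidegree $\pmb{p}$ on $\mathcal{M}_1$ (those with consecutive knots in the two knot vectors of $\mathcal{M}_1$). For $i=1,\dots,N-1$ start with $\mathcal{B}_{i+1}=\mathcal{B}_i$ and, while some $B[\pmb{x},\pmb{y}]\in\mathcal{B}_{i+1}$ does not have minimal support on $\mathcal{M}_{i+1}$, perform knot insertion: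 insert into $\pmb{x}$ (or $\pmb{y}$) the knot of a split of $\mathcal{M}_{i+1}$ traversing it, and replace $B[\pmb{x},\pmb{y}]$ in $\mathcal{B}_{i+1}$ by the two B-splines obtained from the first and the last $p_1+2$ (resp. $p_2+2$) knots of the enlarged knot vector, the other knot vector being unchanged. Then $\mathcal{B}^{\mathcal{LR}}(\mathcal{M})=\mathcal{B}_N$. *)

theory Defs
  imports "HOL-Analysis.Analysis" "HOL-Library.Function_Algebras" "HOL-Library.Sublist"
begin

section \<open>Segments and box-partitions\<close>

type_synonym point = "real \<times> real"

text \<open>\<open>Vert\<close> is direction 1 (vertical) and \<open>Horiz\<close> is direction 2 (horizontal).\<close>

datatype dir = Vert | Horiz

primrec orth :: "dir \<Rightarrow> dir" where
  "orth Vert = Horiz"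
| "orth Horiz = Vert"

text \<open>The component of a bidegree \<open>(p\<^sub>1, p\<^sub>2)\<close> belonging to a direction.\<close>

primrec deg :: "nat \<times> nat \<Rightarrow> dir \<Rightarrow> nat" where
  "deg p Vert = fst p"
| "deg p Horiz = snd p"

text \<open>The point at parameter \<open>t\<close> of the line of direction \<open>k\<close> whose constant coordinate is \<open>c\<close>.\<close>

primrec pt :: "dir \<Rightarrow> real \<Rightarrow> real \<Rightarrow> point" where
  "pt Vert c t = (c, t)"
| "pt Horiz c t = (t, c)"

text \<open>The coordinate that is constant on lines of direction \<open>k\<close>.\<close>

primrec coord :: "dir \<Rightarrow> point \<Rightarrow> real" where
  "coord Vert q = fst q"
| "coord Horiz q = snd q"

definition seg :: "dir \<Rightarrow> real \<Rightarrow> real \<Rightarrow> real \<Rightarrow> point set" where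
  "seg k c a b = pt k c ` {a..b}"

definition is_seg :: "dir \<Rightarrow> point set \<Rightarrow> bool" where
  "is_seg k \<gamma> \<longleftrightarrow> (\<exists>c a b. a < b \<and> \<gamma> = seg k c a b)"

definition rectangle :: "point set \<Rightarrow> bool" where
  "rectangle R \<longleftrightarrow> (\<exists>a b c d. a < b \<and> c < d \<and> R = {a..b} \<times> {c..d})"

definition box_partition :: "point set set \<Rightarrow> point set \<Rightarrow> bool" where
  "box_partition E \<Omega> \<longleftrightarrow> rectangle \<Omega> \<and> (\<forall>\<beta>\<in>E. rectangle \<beta>) \<and> E division_of \<Omega>"

definition vertices :: "point set set \<Rightarrow> point set" where
  "vertices E =
     \<Union>{{a, b} \<times> {c, d} | a b c d. a < b \<and> c < d \<and> {a..b} \<times> {c..d} \<in> E}"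

definition meshlines :: "dir \<Rightarrow> point set set \<Rightarrow> point set set" where
  "meshlines k E =
     {seg k c a b | c a b. a < b \<and> seg k c a b \<subseteq> (\<Union>\<beta>\<in>E. frontier \<beta>) \<and>
                          seg k c a b \<inter> vertices E = {pt k c a, pt k c b}}"

definition traverses :: "point set \<Rightarrow> point set \<Rightarrow> bool" where
  "traverses \<gamma> \<beta> \<longleftrightarrow> \<not> connected (\<beta> - \<gamma>)"

text \<open>A finite union of segments is a union of contiguous and colinear ones precisely if it
  is itself a segment. A constituent traversing an element \<open>\<beta>\<close> is taken inside \<open>\<beta>\<close>, so
  that it does not end in the interior of a neighbouring element.\<close>

definition split :: "dir \<Rightarrow> point set set \<Rightarrow> point set \<Rightarrow> bool" where
  "split k E \<gamma> \<longleftrightarrow> is_seg k \<gamma> \<and>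
     (\<exists>S. finite S \<and> \<Union>S = \<gamma> \<and>
        (\<forall>s\<in>S. is_seg k s \<and>
           (s \<in> meshlines k E \<or> (\<exists>\<beta>\<in>E. s \<subseteq> \<beta> \<and> traverses s \<beta>))))"

section \<open>Meshes with multiplicities\<close>

text \<open>Only the values of \<open>mult\<close> on the meshlines of \<open>elems\<close> are meaningful.\<close>

record mesh =
  elems :: "point set set"
  mult :: "point set \<Rightarrow> nat"

definition mesh_split :: "dir \<Rightarrow> mesh \<Rightarrow> point set \<Rightarrow> bool" where
  "mesh_split k M \<gamma> \<longleftrightarrow> is_seg k \<gamma> \<and>
     (\<exists>S. finite S \<and> S \<subseteq> meshlines k (elems M) \<and> \<Union>S = \<gamma>)"

definition maximal_split :: "dir \<Rightarrow> mesh \<Rightarrow> point set \<Rightarrow> bool" where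
  "maximal_split k M \<gamma> \<longleftrightarrow> mesh_split k M \<gamma> \<and>
     (\<forall>s\<in>meshlines k (elems M). is_seg k (s \<union> \<gamma>) \<longrightarrow> s \<subseteq> \<gamma>)"

definition constant_splits :: "mesh \<Rightarrow> bool" where
  "constant_splits M \<longleftrightarrow>
     (\<forall>k \<gamma>. maximal_split k M \<gamma> \<longrightarrow>
        (\<forall>s\<in>meshlines k (elems M). \<forall>t\<in>meshlines k (elems M).
           s \<subseteq> \<gamma> \<and> t \<subseteq> \<gamma> \<longrightarrow> mult M s = mult M t))"

text \<open>The common multiplicity of the meshlines of a split; meaningful under constant splits.\<close>

definition split_mult :: "mesh \<Rightarrow> point set \<Rightarrow> nat" where
  "split_mult M \<gamma> =
     (THE m. \<forall>k. \<forall>s\<in>meshlines k (elems M). s \<subseteq> \<gamma> \<longrightarrow> mult M s = m)"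

definition box_mesh :: "nat \<times> nat \<Rightarrow> mesh \<Rightarrow> bool" where
  "box_mesh p M \<longleftrightarrow>
     (\<exists>\<Omega>. box_partition (elems M) \<Omega>) \<and>
     (\<forall>k. \<forall>s\<in>meshlines k (elems M). 1 \<le> mult M s \<and> mult M s \<le> deg p k + 1)"

definition cut_elems :: "dir \<Rightarrow> real \<Rightarrow> point set \<Rightarrow> point set set \<Rightarrow> point set set" where
  "cut_elems k c \<gamma> E =
     {\<beta> \<in> E. \<not> traverses \<gamma> \<beta>} \<union>
     {\<beta> \<inter> {q. coord k q \<le> c} | \<beta>. \<beta> \<in> E \<and> traverses \<gamma> \<beta>} \<union>
     {\<beta> \<inter> {q. c \<le> coord k q} | \<beta>. \<beta> \<in> E \<and> traverses \<gamma> \<beta>}"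

text \<open>\<open>inserted k \<gamma> m M M'\<close> says that \<open>M'\<close> is \<open>M + \<gamma>\<close> for the \<open>k\<close>-split \<open>\<gamma>\<close> with
  multiplicity \<open>m\<close>. Inserting \<open>\<gamma>\<close> can subdivide the meshlines orthogonal to it, hence a meshline of
  \<open>M'\<close> takes its old multiplicity from the meshline of \<open>M\<close> in which it is contained.\<close>

definition inserted :: "dir \<Rightarrow> point set \<Rightarrow> nat \<Rightarrow> mesh \<Rightarrow> mesh \<Rightarrow> bool" where
  "inserted k \<gamma> m M M' \<longleftrightarrow>
     1 \<le> m \<and> split k (elems M) \<gamma> \<and>
     (\<exists>c a b. \<gamma> = seg k c a b \<and> elems M' = cut_elems k c \<gamma> (elems M)) \<and>
     (\<forall>l. \<forall>s\<in>meshlines l (elems M').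
        (\<forall>t\<in>meshlines l (elems M). s \<subseteq> t \<longrightarrow>
            mult M' s = (if s \<subseteq> \<gamma> then mult M t + m else mult M t)) \<and>
        (s \<subseteq> \<gamma> \<and> \<not> (\<exists>t\<in>meshlines l (elems M). s \<subseteq> t) \<longrightarrow> mult M' s = m))"

section \<open>LR-meshes\<close>

definition tensor_mesh :: "real list \<Rightarrow> real list \<Rightarrow> mesh \<Rightarrow> bool" where
  "tensor_mesh \<tau>\<^sub>1 \<tau>\<^sub>2 M \<longleftrightarrow>
     sorted_wrt (<) \<tau>\<^sub>1 \<and> sorted_wrt (<) \<tau>\<^sub>2 \<and> 2 \<le> length \<tau>\<^sub>1 \<and> 2 \<le> length \<tau>\<^sub>2 \<and>
     elems M = {{\<tau>\<^sub>1 ! i..\<tau>\<^sub>1 ! Suc i} \<times> {\<tau>\<^sub>2 ! j..\<tau>\<^sub>2 ! Suc j} | i j.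
                  Suc i < length \<tau>\<^sub>1 \<and> Suc j < length \<tau>\<^sub>2}"

definition LR_rule1 :: "nat \<times> nat \<Rightarrow> mesh \<Rightarrow> bool" where
  "LR_rule1 p M \<longleftrightarrow>
     (\<forall>k. deg p k + 2 \<le> (\<Sum>\<gamma> | maximal_split k M \<gamma>. split_mult M \<gamma>))"

definition split_length :: "dir \<Rightarrow> mesh \<Rightarrow> point set \<Rightarrow> nat" where
  "split_length k M \<gamma> =
     (\<Sum>v\<in>vertices (elems M) \<inter> \<gamma>. Max (mult M ` {t \<in> meshlines (orth k) (elems M). v \<in> t}))"

definition LR_rule2 :: "nat \<times> nat \<Rightarrow> mesh \<Rightarrow> bool" where
  "LR_rule2 p M \<longleftrightarrow>
     (\<forall>k \<gamma>. maximal_split k M \<gamma> \<longrightarrow> deg p (orth k) + 2 \<le> split_length k M \<gamma>)"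

text \<open>\<open>Ms 1, \<dots>, Ms N\<close> is a construction sequence of the LR-mesh \<open>Ms N\<close>, starting from the tensor
  product mesh on the sequences \<open>\<tau>\<^sub>1\<close> and \<open>\<tau>\<^sub>2\<close>.\<close>

definition LR_sequence ::
  "nat \<times> nat \<Rightarrow> real list \<Rightarrow> real list \<Rightarrow> (nat \<Rightarrow> mesh) \<Rightarrow> nat \<Rightarrow> bool" where
  "LR_sequence p \<tau>\<^sub>1 \<tau>\<^sub>2 Ms N \<longleftrightarrow>
     1 \<le> N \<and> tensor_mesh \<tau>\<^sub>1 \<tau>\<^sub>2 (Ms 1) \<and> LR_rule1 p (Ms 1) \<and>
     (\<forall>i\<in>{1..N}. box_mesh p (Ms i) \<and> constant_splits (Ms i) \<and> LR_rule2 p (Ms i)) \<and>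
     (\<forall>i\<in>{1..<N}. \<exists>k \<gamma> m. inserted k \<gamma> m (Ms i) (Ms (Suc i)))"

definition LR_mesh :: "nat \<times> nat \<Rightarrow> mesh \<Rightarrow> bool" where
  "LR_mesh p M \<longleftrightarrow> (\<exists>\<tau>\<^sub>1 \<tau>\<^sub>2 Ms N. LR_sequence p \<tau>\<^sub>1 \<tau>\<^sub>2 Ms N \<and> M = Ms N)"

section \<open>B-splines\<close>

text \<open>\<open>bspline p ts\<close> is the univariate B-spline of degree \<open>p\<close> on the knot vector \<open>ts\<close> of length
  \<open>p + 2\<close>. In the recursion, division by zero yields \<open>0\<close>, which is the required convention.\<close>

primrec bspline :: "nat \<Rightarrow> real list \<Rightarrow> real \<Rightarrow> real" where
  "bspline 0 ts t = indicator {ts ! 0..<ts ! 1} t"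
| "bspline (Suc p) ts t =
     (t - ts ! 0) / (ts ! (p + 1) - ts ! 0) * bspline p (butlast ts) t +
     (ts ! (p + 2) - t) / (ts ! (p + 2) - ts ! 1) * bspline p (tl ts) t"

text \<open>A bivariate B-spline is handled through its pair of knot vectors.\<close>

type_synonym knots = "real list \<times> real list"

definition knots_ok :: "nat \<times> nat \<Rightarrow> knots \<Rightarrow> bool" where
  "knots_ok p B \<longleftrightarrow>
     sorted (fst B) \<and> sorted (snd B) \<and> length (fst B) = fst p + 2 \<and> length (snd B) = snd p + 2"

definition tp_bspline :: "nat \<times> nat \<Rightarrow> knots \<Rightarrow> point \<Rightarrow> real" where
  "tp_bspline p B = (\<lambda>(s, t). bspline (fst p) (fst B) s * bspline (snd p) (snd B) t)"

definition supp :: "knots \<Rightarrow> point set" where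
  "supp B = {hd (fst B)..last (fst B)} \<times> {hd (snd B)..last (snd B)}"

text \<open>The splits of a B-spline, paired with their multiplicities.\<close>

definition bspline_splits :: "knots \<Rightarrow> (point set \<times> nat) set" where
  "bspline_splits B =
     {(seg Vert c (hd (snd B)) (last (snd B)), count_list (fst B) c) | c. c \<in> set (fst B)} \<union>
     {(seg Horiz c (hd (fst B)) (last (fst B)), count_list (snd B) c) | c. c \<in> set (snd B)}"

definition traverses_bspline :: "point set \<Rightarrow> knots \<Rightarrow> bool" where
  "traverses_bspline \<gamma> B \<longleftrightarrow> \<not> connected (interior (supp B) - \<gamma>)"

definition has_support :: "mesh \<Rightarrow> knots \<Rightarrow> bool" where
  "has_support M B \<longleftrightarrow>
     supp B \<subseteq> \<Union>(elems M) \<and>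
     (\<forall>(\<sigma>, m)\<in>bspline_splits B. \<exists>k \<gamma>. mesh_split k M \<gamma> \<and> \<sigma> \<subseteq> \<gamma> \<and> m \<le> split_mult M \<gamma>)"

definition minimal_support :: "mesh \<Rightarrow> knots \<Rightarrow> bool" where
  "minimal_support M B \<longleftrightarrow>
     has_support M B \<and>
     (\<forall>k \<gamma>. mesh_split k M \<gamma> \<and> \<gamma> \<inter> interior (supp B) \<noteq> {} \<longrightarrow>
        (traverses_bspline \<gamma> B \<longleftrightarrow>
           (\<exists>(\<sigma>, m)\<in>bspline_splits B. m = split_mult M \<gamma> \<and> \<sigma> \<subseteq> \<gamma>)))"

definition MS_bsplines :: "nat \<times> nat \<Rightarrow> mesh \<Rightarrow> (point \<Rightarrow> real) set" where
  "MS_bsplines p M = tp_bspline p ` {B. knots_ok p B \<and> minimal_support M B}"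

section \<open>LR B-splines\<close>

text \<open>The knot vectors of the tensor product mesh repeat each knot according to the multiplicity
  of its split; \<open>sublist\<close> selects consecutive entries.\<close>

definition tensor_bsplines ::
  "nat \<times> nat \<Rightarrow> real list \<Rightarrow> real list \<Rightarrow> mesh \<Rightarrow> knots set" where
  "tensor_bsplines p \<tau>\<^sub>1 \<tau>\<^sub>2 M =
     {(x, y). length x = fst p + 2 \<and> length y = snd p + 2 \<and>
        sublist x (concat (map
          (\<lambda>c. replicate (split_mult M (seg Vert c (hd \<tau>\<^sub>2) (last \<tau>\<^sub>2))) c) \<tau>\<^sub>1)) \<and>
        sublist y (concat (map
          (\<lambda>c. replicate (split_mult M (seg Horiz c (hd \<tau>\<^sub>1) (last \<tau>\<^sub>1))) c) \<tau>\<^sub>2))}"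

primrec refine_left :: "dir \<Rightarrow> real \<Rightarrow> knots \<Rightarrow> knots" where
  "refine_left Vert c B = (butlast (insort c (fst B)), snd B)"
| "refine_left Horiz c B = (fst B, butlast (insort c (snd B)))"

primrec refine_right :: "dir \<Rightarrow> real \<Rightarrow> knots \<Rightarrow> knots" where
  "refine_right Vert c B = (tl (insort c (fst B)), snd B)"
| "refine_right Horiz c B = (fst B, tl (insort c (snd B)))"

definition knot_insertion :: "mesh \<Rightarrow> knots set \<Rightarrow> knots set \<Rightarrow> bool" where
  "knot_insertion M \<B> \<B>' \<longleftrightarrow>
     (\<exists>B\<in>\<B>. \<not> minimal_support M B \<and>
        (\<exists>k c a b. mesh_split k M (seg k c a b) \<and> traverses_bspline (seg k c a b) B \<and>
           \<B>' = (\<B> - {B}) \<union> {refine_left k c B, refine_right k c B}))"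

text \<open>\<open>Bs 1, \<dots>, Bs N\<close> are the collections of a run of the LR procedure along \<open>Ms 1, \<dots>, Ms N\<close>.
  The order of the knot insertions is not prescribed; each stage ends when every B-spline
  of the current collection has minimal support.\<close>

definition LR_run ::
  "nat \<times> nat \<Rightarrow> real list \<Rightarrow> real list \<Rightarrow> (nat \<Rightarrow> mesh) \<Rightarrow> nat \<Rightarrow> (nat \<Rightarrow> knots set) \<Rightarrow> bool" where
  "LR_run p \<tau>\<^sub>1 \<tau>\<^sub>2 Ms N Bs \<longleftrightarrow>
     LR_sequence p \<tau>\<^sub>1 \<tau>\<^sub>2 Ms N \<and> Bs 1 = tensor_bsplines p \<tau>\<^sub>1 \<tau>\<^sub>2 (Ms 1) \<and>
     (\<forall>i\<in>{1..<N}. (knot_insertion (Ms (Suc i)))\<^sup>*\<^sup>* (Bs i) (Bs (Suc i)) \<and>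
                  (\<forall>B\<in>Bs (Suc i). minimal_support (Ms (Suc i)) B))"

text \<open>\<open>F\<close> is the set of LR B-splines produced by some run along a construction sequence of \<open>M\<close>.\<close>

definition is_LR_bsplines :: "nat \<times> nat \<Rightarrow> mesh \<Rightarrow> (point \<Rightarrow> real) set \<Rightarrow> bool" where
  "is_LR_bsplines p M F \<longleftrightarrow>
     (\<exists>\<tau>\<^sub>1 \<tau>\<^sub>2 Ms N Bs. LR_run p \<tau>\<^sub>1 \<tau>\<^sub>2 Ms N Bs \<and> M = Ms N \<and> F = tp_bspline p ` Bs N)"

section \<open>The vector space of real functions on the plane\<close>

definition fun_scale :: "real \<Rightarrow> (point \<Rightarrow> real) \<Rightarrow> point \<Rightarrow> real" where
  "fun_scale c f = (\<lambda>q. c * f q)"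

global_interpretation fun_space: vector_space fun_scale
  by unfold_locales (auto simp: fun_scale_def fun_eq_iff algebra_simps)

end

theory Submission
  imports Defs
begin

text \<open>In bidegree \<open>(0, 0)\<close> all multiplicities are 1, and a minimal support is a rectangle with edges on
  the mesh whose interior no split of the mesh traverses. Whenever an insertion meets the interior of
  an element, it cuts the whole element; hence, by induction along the construction, a rectangle that is
  not traversed lies in a single element. (Meshes of pinwheel type, where this fails, are not LR-meshes.)
  As its edges avoid the interior of that element, the support is the element itself, and the
  B-splines are indicators of elements with disjoint interiors.\<close>

section \<open>Rectangles and segments\<close>

lemma coord_pt [simp]: "coord k (pt k c t) = c" "coord (orth k) (pt k c t) = t"
  by (cases k; simp)+

lemma pt_coord [simp]: "pt k (coord k q) (coord (orth k) q) = q"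
  by (cases k) auto

lemma pt_eq_iff [simp]: "pt k c t = pt k c' t' \<longleftrightarrow> c = c' \<and> t = t'"
  by (cases k) auto

lemma continuous_on_coord: "continuous_on A (coord k)"
  by (cases k) (auto simp: continuous_on_fst continuous_on_snd continuous_on_id coord_def[abs_def])

text \<open>The first interval bounds the coordinate that is constant on lines of direction
  \<open>k\<close>, the second the coordinate along them. One argument thus serves vertical and
  horizontal segments alike.\<close>

definition rect :: "dir \<Rightarrow> real \<Rightarrow> real \<Rightarrow> real \<Rightarrow> real \<Rightarrow> point set" where
  "rect k u v w z = {q. coord k q \<in> {u..v} \<and> coord (orth k) q \<in> {w..z}}"

lemma rect_Vert: "rect Vert u v w z = {u..v} \<times> {w..z}"
  and rect_Horiz: "rect Horiz u v w z = {w..z} \<times> {u..v}"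
  by (auto simp: rect_def)

lemma pt_in_rect [simp]: "pt k c t \<in> rect k u v w z \<longleftrightarrow> c \<in> {u..v} \<and> t \<in> {w..z}"
  by (auto simp: rect_def)

lemma closed_rect: "closed (rect k u v w z)"
  by (cases k) (auto simp: rect_Vert rect_Horiz closed_Times)

lemma convex_rect: "convex (rect k u v w z)"
  by (cases k) (auto simp: rect_Vert rect_Horiz convex_Times)

lemma interior_rect:
  "interior (rect k u v w z) = {q. coord k q \<in> {u<..<v} \<and> coord (orth k) q \<in> {w<..<z}}"
  by (cases k) (auto simp: rect_Vert rect_Horiz interior_Times)

lemma frontier_rect: "frontier (rect k u v w z) = rect k u v w z - interior (rect k u v w z)"
  by (simp add: frontier_def closure_closed closed_rect)

lemma closure_interior_rect:
  assumes "u < v" "w < z"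
  shows "closure (interior (rect k u v w z)) = rect k u v w z"
proof -
  have "pt k ((u + v) / 2) ((w + z) / 2) \<in> interior (rect k u v w z)"
    using assms by (simp add: interior_rect)
  then show ?thesis
    by (subst convex_closure_interior) (auto simp: convex_rect closure_closed closed_rect)
qed

lemma rect_subset_rect:
  assumes "u < v" "w < z" "rect k u v w z \<subseteq> rect k u' v' w' z'"
  shows "u' \<le> u" "v \<le> v'" "w' \<le> w" "z \<le> z'"
proof -
  have "pt k u w \<in> rect k u' v' w' z'" "pt k v z \<in> rect k u' v' w' z'"
    using assms(1,2) by (auto intro: subsetD[OF assms(3)] simp del: pt_in_rect simp: pt_in_rect[of k _ _ u v w z])
  then show "u' \<le> u" "v \<le> v'" "w' \<le> w" "z \<le> z'" by auto
qed

lemma rectangle_iff_rect: "rectangle R \<longleftrightarrow> (\<exists>u v w z. u < v \<and> w < z \<and> R = rect k u v w z)"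
  by (cases k) (auto simp: rectangle_def rect_Vert rect_Horiz)

lemma rectangleE:
  assumes "rectangle R"
  obtains u v w z where "u < v" "w < z" "R = rect k u v w z"
  using assms unfolding rectangle_iff_rect[of R k] by blast

lemma mem_seg: "q \<in> seg k c a b \<longleftrightarrow> coord k q = c \<and> coord (orth k) q \<in> {a..b}"
  unfolding seg_def image_iff by (metis coord_pt pt_coord)

text \<open>Topological traversal reduced to inequalities: the line runs strictly between two
  opposite sides, and the segment reaches from end to end. \<open>traverses_rect_imp\<close>
  extracts the same inequalities from disconnection.\<close>

definition crosses :: "dir \<Rightarrow> real \<Rightarrow> real \<Rightarrow> real \<Rightarrow> point set \<Rightarrow> bool" where
  "crosses k c a b R \<longleftrightarrow>
     (\<exists>u v w z. u < c \<and> c < v \<and> w < z \<and> a \<le> w \<and> z \<le> b \<and> R = rect k u v w z)"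

text \<open>The two open half-planes beside the line separate what is left of the interior, because
  the segment removes every interior point on the line. The two conclusions are what
  \<open>minimal_support\<close> asks of a traversing split.\<close>

lemma crosses_disconnects_interior:
  assumes "crosses k c a b R"
  shows "\<not> connected (interior R - seg k c a b)" "seg k c a b \<inter> interior R \<noteq> {}"
proof -
  obtain u v w z where *: "u < c" "c < v" "w < z" "a \<le> w" "z \<le> b" and R: "R = rect k u v w z"
    using assms unfolding crosses_def by blast
  let ?t = "(w + z) / 2"
  have "open {q. coord k q < c}" "open {q. c < coord k q}"
    by (auto intro!: open_Collect_less continuous_on_coord continuous_on_const)
  moreover have "pt k ((u + c) / 2) ?t \<in> {q. coord k q < c} \<inter> (interior R - seg k c a b)"
    "pt k ((c + v) / 2) ?t \<in> {q. c < coord k q} \<inter> (interior R - seg k c a b)"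
    using * by (auto simp: R interior_rect mem_seg)
  moreover have "interior R - seg k c a b \<subseteq> {q. coord k q < c} \<union> {q. c < coord k q}"
    using * by (auto simp: R interior_rect mem_seg)
  moreover have "{q. coord k q < c} \<inter> {q. c < coord k q} \<inter> (interior R - seg k c a b) = {}"
    by auto
  ultimately show "\<not> connected (interior R - seg k c a b)"
    unfolding connected_def by blast
  have "pt k c ?t \<in> seg k c a b \<inter> interior R"
    using * by (auto simp: R interior_rect mem_seg)
  then show "seg k c a b \<inter> interior R \<noteq> {}" by blast
qed

text \<open>If the segment misses a strip of the rectangle, that strip joins the two open halves, and
  the rest of the rectangle lies in the closure of the resulting connected set.\<close>

lemma traverses_rect_imp:
  assumes "u < v" "w < z" "traverses (seg k c a b) (rect k u v w z)"
  shows "u < c \<and> c < v \<and> a \<le> w \<and> z \<le> b"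
proof (rule ccontr)
  assume neg: "\<not> ?thesis"
  let ?T = "rect k u v w z - seg k c a b"
  let ?I = "\<lambda>u v w z. interior (rect k u v w z)"
  have conn: "connected (?I u v w z)" for u v w z
    by (intro convex_connected convex_interior convex_rect)
  have "connected ?T"
  proof (cases "u < c \<and> c < v")
    case False
    \<comment> \<open>The line misses the open rectangle, so removing the segment takes away
      boundary points only.\<close>
    then have "?I u v w z \<subseteq> ?T"
      unfolding interior_rect by (auto simp: rect_def mem_seg)
    then show ?thesis
      by (rule connected_intermediate_closure[OF conn])
         (auto simp: closure_interior_rect assms)
  next
    case True
    then have "w < a \<or> b < z" using neg by auto
    \<comment> \<open>The strip between \<open>s\<close> and \<open>t\<close> lies beyond an end of
      the segment; \<open>min\<close> and \<open>max\<close> keep it inside the rectangle when the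
      whole segment lies beyond it.\<close>
    then obtain s t where st: "s < t" "w \<le> s" "t \<le> z" "b \<le> s \<or> t \<le> a"
    proof
      assume "w < a" then show thesis using assms by (intro that[of w "min a z"]) auto
    next
      assume "b < z" then show thesis using assms by (intro that[of "max b w" z]) auto
    qed
    let ?m = "(s + t) / 2"
    let ?L = "?I u c w z" and ?R = "?I c v w z" and ?J = "?I u v s t"
    have "pt k ((u + c) / 2) ?m \<in> ?L \<inter> ?J" "pt k ((c + v) / 2) ?m \<in> ?R \<inter> ?J"
      using True st by (auto simp: interior_rect)
    then have "connected ((?L \<union> ?J) \<union> ?R)"
      by (intro connected_Un conn) blast+
    moreover have "(?L \<union> ?J) \<union> ?R \<subseteq> ?T"
      using True st unfolding interior_rect by (auto simp: rect_def mem_seg)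
    moreover have "?T \<subseteq> closure ((?L \<union> ?J) \<union> ?R)"
    proof -
      have "rect k u v w z \<subseteq> rect k u c w z \<union> rect k c v w z"
        by (auto simp: rect_def)
      also have "\<dots> \<subseteq> closure ((?L \<union> ?J) \<union> ?R)"
        using True assms by (auto simp: closure_Un closure_interior_rect)
      finally show ?thesis by blast
    qed
    ultimately show ?thesis by (rule connected_intermediate_closure)
  qed
  with assms(3) show False by (simp add: traverses_def)
qed

section \<open>Splits of a mesh\<close>

lemma vertices_rect_iff:
  "q \<in> vertices E \<longleftrightarrow>
     (\<exists>u v w z. u < v \<and> w < z \<and> rect k u v w z \<in> E \<and> coord k q \<in> {u, v} \<and> coord (orth k) q \<in> {w, z})"
proof (cases q)
  case (Pair x y)
  show ?thesis
  proof (cases k)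
    case Vert
    then show ?thesis unfolding Pair vertices_def by (auto simp: rect_Vert) blast+
  next
    case Horiz
    then show ?thesis unfolding Pair vertices_def by (auto simp: rect_Horiz) blast+
  qed
qed

lemma finite_vertices:
  assumes "finite E"
  shows "finite (vertices E)"
proof -
  \<comment> \<open>The infima and suprema of its projections recover the corners of an element from
    the bare set, so each element contributes at most four vertices.\<close>
  have "vertices E \<subseteq> (\<Union>\<beta>\<in>E. {Inf (fst ` \<beta>), Sup (fst ` \<beta>)} \<times> {Inf (snd ` \<beta>), Sup (snd ` \<beta>)})"
  proof
    fix q assume "q \<in> vertices E"
    then obtain u v w z where "u < v" "w < z" "{u..v} \<times> {w..z} \<in> E" "fst q \<in> {u, v}" "snd q \<in> {w, z}"
      unfolding vertices_rect_iff[of q E Vert] by (auto simp: rect_Vert)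
    then show "q \<in> (\<Union>\<beta>\<in>E. {Inf (fst ` \<beta>), Sup (fst ` \<beta>)} \<times> {Inf (snd ` \<beta>), Sup (snd ` \<beta>)})"
      by (intro UN_I[of "{u..v} \<times> {w..z}"]) (auto simp: mem_Times_iff)
  qed
  then show ?thesis
    by (rule finite_subset) (use assms in auto)
qed

text \<open>Further vertices may lie between the two ends. Hence, unlike a meshline, such a segment
  remains one when an insertion creates new vertices on it.\<close>

definition mesh_seg :: "point set set \<Rightarrow> dir \<Rightarrow> real \<Rightarrow> real \<Rightarrow> real \<Rightarrow> bool" where
  "mesh_seg E k c a b \<longleftrightarrow> a < b \<and> seg k c a b \<subseteq> (\<Union>\<beta>\<in>E. frontier \<beta>) \<and>
     pt k c a \<in> vertices E \<and> pt k c b \<in> vertices E"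

text \<open>Applied to the vertices on a mesh segment, this yields the meshline through a given
  point of it.\<close>

lemma finite_set_consecutive:
  fixes V :: "real set"
  assumes "finite V" "a \<in> V" "b \<in> V" "a \<le> t" "t \<le> b" "a < b"
  obtains u v where "u \<in> V" "v \<in> V" "u < v" "u \<le> t" "t \<le> v" "{u<..<v} \<inter> V = {}"
proof (cases "t = b")
  \<comment> \<open>At the right end, the greatest element not above \<open>t\<close> is
    \<open>b\<close> itself and may have no successor in \<open>V\<close>; the pair therefore has to
    end at \<open>b\<close>.\<close>
  case True
  have "Max {x \<in> V. x < b} \<in> {x \<in> V. x < b}"
    using assms by (intro Max_in) auto
  moreover have "\<forall>x\<in>V. x < b \<longrightarrow> x \<le> Max {x \<in> V. x < b}"
    using assms by (auto intro!: Max_ge)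
  ultimately obtain u where "u \<in> V" "u < b" "\<forall>x\<in>V. x < b \<longrightarrow> x \<le> u" by blast
  with assms True show thesis
    by (intro that[of u b]) (auto simp: disjoint_iff not_less)
next
  case False
  have "Max {x \<in> V. x \<le> t} \<in> {x \<in> V. x \<le> t}"
    using assms by (intro Max_in) auto
  moreover have "\<forall>x\<in>V. x \<le> t \<longrightarrow> x \<le> Max {x \<in> V. x \<le> t}"
    using assms by (auto intro!: Max_ge)
  ultimately obtain u where u: "u \<in> V" "u \<le> t" "\<forall>x\<in>V. x \<le> t \<longrightarrow> x \<le> u" by blast
  have "b \<in> {x \<in> V. t < x}"
    using assms False by auto
  then have "Min {x \<in> V. t < x} \<in> {x \<in> V. t < x}"
    using assms by (intro Min_in) auto
  moreover have "\<forall>x\<in>V. t < x \<longrightarrow> Min {x \<in> V. t < x} \<le> x"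
    using assms by (auto intro!: Min_le)
  ultimately obtain v where v: "v \<in> V" "t < v" "\<forall>x\<in>V. t < x \<longrightarrow> v \<le> x" by blast
  have "{u<..<v} \<inter> V = {}"
  proof (intro equals0I)
    fix x assume "x \<in> {u<..<v} \<inter> V"
    with u(3) v(3) show False by (cases "x \<le> t") fastforce+
  qed
  with u v show thesis
    by (intro that[of u v]) auto
qed

text \<open>The vertices on the segment are finitely many and include both ends. They cut it into
  pieces between consecutive vertices, and each piece is a meshline.\<close>

lemma mesh_seg_imp_mesh_split:
  assumes "finite (elems M)" "mesh_seg (elems M) k c a b"
  shows "mesh_split k M (seg k c a b)"
proof -
  let ?E = "elems M"
  have ab: "a < b" and sub: "seg k c a b \<subseteq> (\<Union>\<beta>\<in>?E. frontier \<beta>)"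
    and vert: "pt k c a \<in> vertices ?E" "pt k c b \<in> vertices ?E"
    using assms(2) unfolding mesh_seg_def by auto
  define V where "V = {t \<in> {a..b}. pt k c t \<in> vertices ?E}"
  have "finite (pt k c -` vertices ?E)"
    by (rule finite_vimageI[OF finite_vertices[OF assms(1)]]) (auto simp: inj_def)
  then have finV: "finite V"
    by (rule rev_finite_subset) (auto simp: V_def)
  define S where "S = {seg k c u v | u v. u \<in> V \<and> v \<in> V \<and> u < v \<and> {u<..<v} \<inter> V = {}}"
  have "S \<subseteq> (\<lambda>(u, v). seg k c u v) ` (V \<times> V)"
    by (auto simp: S_def)
  then have "finite S"
    by (rule finite_subset) (use finV in auto)
  moreover have "S \<subseteq> meshlines k ?E"
  proof
    fix s assume "s \<in> S"
    then obtain u v where uv: "u \<in> V" "v \<in> V" "u < v" "{u<..<v} \<inter> V = {}" and s: "s = seg k c u v"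
      unfolding S_def by blast
    have "s \<subseteq> seg k c a b"
      using uv by (auto simp: s mem_seg V_def)
    moreover have "s \<inter> vertices ?E = {pt k c u, pt k c v}"
    proof
      show "{pt k c u, pt k c v} \<subseteq> s \<inter> vertices ?E"
        using uv by (auto simp: s mem_seg V_def)
      show "s \<inter> vertices ?E \<subseteq> {pt k c u, pt k c v}"
      proof
        fix q assume q: "q \<in> s \<inter> vertices ?E"
        then obtain t where t: "q = pt k c t" "u \<le> t" "t \<le> v"
          unfolding s seg_def by auto
        with q uv have "t \<in> V" by (auto simp: V_def)
        with uv(4) t have "t = u \<or> t = v" by force
        with t show "q \<in> {pt k c u, pt k c v}" by auto
      qed
    qed
    ultimately show "s \<in> meshlines k ?E"
      using uv sub unfolding meshlines_def s by blast
  qed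
  moreover have "\<Union>S = seg k c a b"
  proof
    show "\<Union>S \<subseteq> seg k c a b"
      by (auto simp: S_def V_def mem_seg)
    show "seg k c a b \<subseteq> \<Union>S"
    proof
      fix q assume "q \<in> seg k c a b"
      then obtain t where t: "q = pt k c t" "a \<le> t" "t \<le> b"
        unfolding seg_def by auto
      have "a \<in> V" "b \<in> V" using ab vert by (auto simp: V_def)
      from finite_set_consecutive[OF finV this t(2,3) ab]
      obtain u v where uv: "u \<in> V" "v \<in> V" "u < v" "u \<le> t" "t \<le> v" "{u<..<v} \<inter> V = {}" .
      then have "q \<in> seg k c u v" by (auto simp: mem_seg t)
      with uv show "q \<in> \<Union>S" unfolding S_def by blast
    qed
  qed
  ultimately show ?thesis
    using ab unfolding mesh_split_def is_seg_def by blast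
qed

lemma mesh_split_subset_frontier:
  "mesh_split k M \<gamma> \<Longrightarrow> \<gamma> \<subseteq> (\<Union>\<beta>\<in>elems M. frontier \<beta>)"
  unfolding mesh_split_def meshlines_def by blast

text \<open>In degree zero \<open>box_mesh\<close> squeezes every multiplicity between 1 and 0 + 1.
  The definite description in \<open>split_mult\<close> is determined because a split is nonempty
  and so contains a meshline.\<close>

lemma split_mult_degree_0:
  assumes "box_mesh (0, 0) M" "mesh_split k M \<gamma>"
  shows "split_mult M \<gamma> = 1"
proof -
  have deg0: "deg (0, 0) l = 0" for l by (cases l) auto
  have one: "mult M s = 1" if "s \<in> meshlines l (elems M)" for l s
    using assms(1) that unfolding box_mesh_def deg0 by (metis add_0 le_antisym)
  obtain S where S: "S \<subseteq> meshlines k (elems M)" "\<Union>S = \<gamma>" and "is_seg k \<gamma>"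
    using assms(2) unfolding mesh_split_def by blast
  then have "\<gamma> \<noteq> {}" by (auto simp: is_seg_def seg_def)
  with S obtain s where "s \<in> meshlines k (elems M)" "s \<subseteq> \<gamma>" by blast
  with one show ?thesis
    unfolding split_mult_def by (intro the_equality) metis+
qed

section \<open>Uncrossed rectangles\<close>

text \<open>The invariant of the induction along the construction. It tests only mesh segments,
  which persist under insertion, so a rectangle uncrossed in the new mesh was already uncrossed in
  the old one.\<close>

definition uncrossed_in_element :: "point set set \<Rightarrow> bool" where
  "uncrossed_in_element E \<longleftrightarrow>
     (\<forall>R. rectangle R \<and> R \<subseteq> \<Union>E \<and> (\<forall>k c a b. mesh_seg E k c a b \<longrightarrow> \<not> crosses k c a b R) \<longrightarrow>
          (\<exists>\<beta>\<in>E. R \<subseteq> \<beta>))"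

section \<open>The invariant for tensor product meshes\<close>

lemma nth_bracket:
  fixes xs :: "real list"
  assumes "xs ! 0 \<le> t" "t \<le> xs ! (length xs - 1)" "2 \<le> length xs"
  obtains j where "Suc j < length xs" "xs ! j \<le> t" "t \<le> xs ! Suc j"
proof -
  \<comment> \<open>Minimality fails the bound at the preceding index, which gives the lower
    estimate; for \<open>j = 0\<close> it is the first hypothesis.\<close>
  define j where "j = (LEAST j. t \<le> xs ! Suc j)"
  have ex: "t \<le> xs ! Suc (length xs - 2)"
    using assms(2,3) by (metis Suc_diff_le diff_Suc_Suc numeral_2_eq_2 One_nat_def)
  then have "t \<le> xs ! Suc j" "j \<le> length xs - 2"
    unfolding j_def by (rule LeastI, rule Least_le)
  moreover have "xs ! j \<le> t"
  proof (cases j)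
    case 0
    then show ?thesis using assms by simp
  next
    case (Suc i)
    then show ?thesis using not_less_Least[of i "\<lambda>j. t \<le> xs ! Suc j"] unfolding j_def by auto
  qed
  ultimately show thesis using assms(3) by (intro that[of j]) auto
qed

lemma sorted_nth_between:
  fixes xs :: "real list"
  assumes "sorted_wrt (<) xs" "i < length xs"
  shows "xs ! 0 \<le> xs ! i" "xs ! i \<le> xs ! (length xs - 1)"
proof -
  have "sorted xs" using assms(1) by (simp add: strict_sorted_imp_sorted)
  then show "xs ! 0 \<le> xs ! i" "xs ! i \<le> xs ! (length xs - 1)"
    using assms(2) by (auto intro!: sorted_nth_mono)
qed

text \<open>Every point of the line lies on the side of some cell in an adjacent column, and both
  ends are corners of cells. Vertical and horizontal grid lines are the two instances, with the
  sequences exchanged.\<close>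

lemma tensor_grid_line_mesh_seg:
  fixes xs ys :: "real list"
  assumes xs: "sorted_wrt (<) xs" "2 \<le> length xs" and ys: "sorted_wrt (<) ys" "2 \<le> length ys"
    and E: "\<And>i j. Suc i < length xs \<Longrightarrow> Suc j < length ys \<Longrightarrow>
              rect k (xs ! i) (xs ! Suc i) (ys ! j) (ys ! Suc j) \<in> E"
    and i: "i < length xs"
  shows "mesh_seg E k (xs ! i) (ys ! 0) (ys ! (length ys - 1))"
proof -
  \<comment> \<open>The column of cells to the right of the line, except at the last line, which has
    a column only on its left.\<close>
  define i' where "i' = (if Suc i < length xs then i else i - 1)"
  have i': "Suc i' < length xs" "i = i' \<or> i = Suc i'"
    using i xs(2) by (auto simp: i'_def)
  have xlt: "xs ! i' < xs ! Suc i'"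
    using xs(1) i' by (simp add: sorted_wrt_nth_less)
  have ylt: "ys ! j < ys ! Suc j" if "Suc j < length ys" for j
    using ys(1) that by (simp add: sorted_wrt_nth_less)
  have i_end: "xs ! i \<in> {xs ! i', xs ! Suc i'}"
    using i'(2) by blast
  have "ys ! 0 < ys ! (length ys - 1)"
    using ys(2) by (intro sorted_wrt_nth_less[OF ys(1)]) simp_all
  moreover have "seg k (xs ! i) (ys ! 0) (ys ! (length ys - 1)) \<subseteq> (\<Union>\<beta>\<in>E. frontier \<beta>)"
  proof
    fix q assume "q \<in> seg k (xs ! i) (ys ! 0) (ys ! (length ys - 1))"
    then have q: "coord k q = xs ! i" "ys ! 0 \<le> coord (orth k) q"
      "coord (orth k) q \<le> ys ! (length ys - 1)"
      by (auto simp: mem_seg)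
    from nth_bracket[OF q(2,3) ys(2)] obtain j where
      j: "Suc j < length ys" "ys ! j \<le> coord (orth k) q" "coord (orth k) q \<le> ys ! Suc j" .
    have "q \<in> frontier (rect k (xs ! i') (xs ! Suc i') (ys ! j) (ys ! Suc j))"
      unfolding frontier_rect interior_rect using q(1) j(2,3) i_end xlt by (auto simp: rect_def)
    with E[OF i'(1) j(1)] show "q \<in> (\<Union>\<beta>\<in>E. frontier \<beta>)" by blast
  qed
  moreover have "pt k (xs ! i) (ys ! 0) \<in> vertices E"
    unfolding vertices_rect_iff[of _ E k] using E[OF i'(1), of 0] ylt[of 0] i_end xlt ys(2)
    by (intro exI[of _ "xs ! i'"] exI[of _ "xs ! Suc i'"] exI[of _ "ys ! 0"] exI[of _ "ys ! Suc 0"]) simp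
  moreover have "pt k (xs ! i) (ys ! (length ys - 1)) \<in> vertices E"
  proof -
    obtain n where n: "length ys = Suc (Suc n)"
      using ys(2) by (auto simp: le_iff_add)
    show ?thesis
      unfolding vertices_rect_iff[of _ E k] using E[OF i'(1), of n] ylt[of n] i_end xlt n
      by (intro exI[of _ "xs ! i'"] exI[of _ "xs ! Suc i'"] exI[of _ "ys ! n"] exI[of _ "ys ! Suc n"]) simp
  qed
  ultimately show ?thesis unfolding mesh_seg_def by blast
qed

lemma tensor_mesh_line_mesh_seg:
  assumes "tensor_mesh \<tau>\<^sub>1 \<tau>\<^sub>2 M"
  shows "i < length \<tau>\<^sub>1 \<Longrightarrow> mesh_seg (elems M) Vert (\<tau>\<^sub>1 ! i) (\<tau>\<^sub>2 ! 0) (\<tau>\<^sub>2 ! (length \<tau>\<^sub>2 - 1))"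
    and "j < length \<tau>\<^sub>2 \<Longrightarrow> mesh_seg (elems M) Horiz (\<tau>\<^sub>2 ! j) (\<tau>\<^sub>1 ! 0) (\<tau>\<^sub>1 ! (length \<tau>\<^sub>1 - 1))"
proof -
  have *: "sorted_wrt (<) \<tau>\<^sub>1" "2 \<le> length \<tau>\<^sub>1" "sorted_wrt (<) \<tau>\<^sub>2" "2 \<le> length \<tau>\<^sub>2"
    using assms unfolding tensor_mesh_def by blast+
  have E: "{\<tau>\<^sub>1 ! i..\<tau>\<^sub>1 ! Suc i} \<times> {\<tau>\<^sub>2 ! j..\<tau>\<^sub>2 ! Suc j} \<in> elems M"
      if "Suc i < length \<tau>\<^sub>1" "Suc j < length \<tau>\<^sub>2" for i j
    using assms that unfolding tensor_mesh_def by blast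
  show "i < length \<tau>\<^sub>1 \<Longrightarrow> mesh_seg (elems M) Vert (\<tau>\<^sub>1 ! i) (\<tau>\<^sub>2 ! 0) (\<tau>\<^sub>2 ! (length \<tau>\<^sub>2 - 1))"
    by (rule tensor_grid_line_mesh_seg) (simp_all only: * E rect_Vert)
  show "j < length \<tau>\<^sub>2 \<Longrightarrow> mesh_seg (elems M) Horiz (\<tau>\<^sub>2 ! j) (\<tau>\<^sub>1 ! 0) (\<tau>\<^sub>1 ! (length \<tau>\<^sub>1 - 1))"
    by (rule tensor_grid_line_mesh_seg) (simp_all only: * E rect_Horiz)
qed

text \<open>Grid lines span the whole mesh, so one passing strictly inside \<open>R\<close> would
  cross it. Thus no knot lies strictly between the sides of \<open>R\<close>, and a cell containing
  the centre of \<open>R\<close> contains all of \<open>R\<close>.\<close>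

lemma tensor_mesh_uncrossed:
  assumes T: "tensor_mesh \<tau>\<^sub>1 \<tau>\<^sub>2 M"
  shows "uncrossed_in_element (elems M)"
  unfolding uncrossed_in_element_def
proof (intro allI impI, elim conjE)
  fix R assume "rectangle R" and sub: "R \<subseteq> \<Union>(elems M)"
    and nc: "\<forall>k c a b. mesh_seg (elems M) k c a b \<longrightarrow> \<not> crosses k c a b R"
  from \<open>rectangle R\<close> obtain x1 x2 y1 y2 where
    lt: "x1 < x2" "y1 < y2" and R: "R = {x1..x2} \<times> {y1..y2}"
    unfolding rectangle_def by blast
  have sorted: "sorted_wrt (<) \<tau>\<^sub>1" "sorted_wrt (<) \<tau>\<^sub>2"
    and E: "elems M = {{\<tau>\<^sub>1 ! i..\<tau>\<^sub>1 ! Suc i} \<times> {\<tau>\<^sub>2 ! j..\<tau>\<^sub>2 ! Suc j} | i j.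
                  Suc i < length \<tau>\<^sub>1 \<and> Suc j < length \<tau>\<^sub>2}"
    using T unfolding tensor_mesh_def by auto
  have range: "\<tau>\<^sub>1 ! 0 \<le> x \<and> x \<le> \<tau>\<^sub>1 ! (length \<tau>\<^sub>1 - 1) \<and> \<tau>\<^sub>2 ! 0 \<le> y \<and> y \<le> \<tau>\<^sub>2 ! (length \<tau>\<^sub>2 - 1)"
    if xy: "(x, y) \<in> R" for x y
  proof -
    obtain i j where "Suc i < length \<tau>\<^sub>1" "Suc j < length \<tau>\<^sub>2"
      "x \<in> {\<tau>\<^sub>1 ! i..\<tau>\<^sub>1 ! Suc i}" "y \<in> {\<tau>\<^sub>2 ! j..\<tau>\<^sub>2 ! Suc j}"
      using subsetD[OF sub xy] unfolding E by auto
    with sorted_nth_between[OF sorted(1), of i] sorted_nth_between[OF sorted(1), of "Suc i"]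
      sorted_nth_between[OF sorted(2), of j] sorted_nth_between[OF sorted(2), of "Suc j"]
    show ?thesis by auto
  qed
  have lo: "\<tau>\<^sub>1 ! 0 \<le> x1" "\<tau>\<^sub>2 ! 0 \<le> y1"
    and hi: "x2 \<le> \<tau>\<^sub>1 ! (length \<tau>\<^sub>1 - 1)" "y2 \<le> \<tau>\<^sub>2 ! (length \<tau>\<^sub>2 - 1)"
    using range[of x1 y1] range[of x2 y2] lt by (auto simp: R)
  have nx: "\<not> (x1 < \<tau>\<^sub>1 ! i \<and> \<tau>\<^sub>1 ! i < x2)" if "i < length \<tau>\<^sub>1" for i
    using nc[rule_format, OF tensor_mesh_line_mesh_seg(1)[OF T that]] lo(2) hi(2) lt(2)
    unfolding crosses_def R rect_Vert by blast
  have ny: "\<not> (y1 < \<tau>\<^sub>2 ! j \<and> \<tau>\<^sub>2 ! j < y2)" if "j < length \<tau>\<^sub>2" for j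
    using nc[rule_format, OF tensor_mesh_line_mesh_seg(2)[OF T that]] lo(1) hi(1) lt(1)
    unfolding crosses_def R rect_Horiz by blast
  have "((x1 + x2) / 2, (y1 + y2) / 2) \<in> \<Union>(elems M)"
    using lt by (intro subsetD[OF sub]) (auto simp: R)
  then obtain i j where ij: "Suc i < length \<tau>\<^sub>1" "Suc j < length \<tau>\<^sub>2"
    and mid: "\<tau>\<^sub>1 ! i \<le> (x1 + x2) / 2" "(x1 + x2) / 2 \<le> \<tau>\<^sub>1 ! Suc i"
      "\<tau>\<^sub>2 ! j \<le> (y1 + y2) / 2" "(y1 + y2) / 2 \<le> \<tau>\<^sub>2 ! Suc j"
    unfolding E by auto
  have "R \<subseteq> {\<tau>\<^sub>1 ! i..\<tau>\<^sub>1 ! Suc i} \<times> {\<tau>\<^sub>2 ! j..\<tau>\<^sub>2 ! Suc j}"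
    unfolding R using nx[of i] nx[of "Suc i"] ny[of j] ny[of "Suc j"] ij mid lt by auto
  with ij show "\<exists>\<beta>\<in>elems M. R \<subseteq> \<beta>" unfolding E by blast
qed

section \<open>Preservation of the invariant under insertion of a split\<close>

lemma rect_halves:
  assumes "u < c" "c < v"
  shows "rect k u v w z \<inter> {q. coord k q \<le> c} = rect k u c w z"
    and "rect k u v w z \<inter> {q. c \<le> coord k q} = rect k c v w z"
  using assms by (auto simp: rect_def)

lemma cut_elems_cases:
  assumes "rectangle \<beta>" "\<beta> \<in> E"
  obtains (kept) "\<beta> \<in> cut_elems k c (seg k c a b) E"
  | (cut) u v w z where "u < c" "c < v" "w < z" "a \<le> w" "z \<le> b" "\<beta> = rect k u v w z"
      "rect k u c w z \<in> cut_elems k c (seg k c a b) E"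
      "rect k c v w z \<in> cut_elems k c (seg k c a b) E"
proof (cases "traverses (seg k c a b) \<beta>")
  case False
  then show thesis using assms by (intro kept) (auto simp: cut_elems_def)
next
  case True
  obtain u v w z where uv: "u < v" "w < z" and \<beta>: "\<beta> = rect k u v w z"
    using rectangleE[OF assms(1)] by metis
  with True have *: "u < c" "c < v" "a \<le> w" "z \<le> b"
    using traverses_rect_imp by blast+
  have "\<beta> \<inter> {q. coord k q \<le> c} \<in> cut_elems k c (seg k c a b) E"
    "\<beta> \<inter> {q. c \<le> coord k q} \<in> cut_elems k c (seg k c a b) E"
    using True assms(2) unfolding cut_elems_def by blast+
  then show thesis
    using * uv by (intro cut[of u v w z]) (auto simp: \<beta> rect_halves)
qed

text \<open>Cutting only adds boundary and vertices: a boundary point of a cut element is a boundary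
  point of one of its halves, and each of its corners is a corner of one of them.\<close>

lemma mesh_seg_cut_elems:
  assumes "\<forall>\<beta>\<in>E. rectangle \<beta>" "mesh_seg E l d s t"
  shows "mesh_seg (cut_elems k c (seg k c a b) E) l d s t"
proof -
  let ?E = "cut_elems k c (seg k c a b) E"
  have "(\<Union>\<beta>\<in>E. frontier \<beta>) \<subseteq> (\<Union>\<beta>\<in>?E. frontier \<beta>)"
  proof
    fix q assume "q \<in> (\<Union>\<beta>\<in>E. frontier \<beta>)"
    then obtain \<beta> where \<beta>: "\<beta> \<in> E" "q \<in> frontier \<beta>" by blast
    with assms(1) have "rectangle \<beta>" by blast
    from this \<beta>(1) show "q \<in> (\<Union>\<beta>\<in>?E. frontier \<beta>)"
    proof (cases rule: cut_elems_cases[of \<beta> E k c a b])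
      case kept
      with \<beta> show ?thesis by blast
    next
      case (cut u v w z)
      have "q \<in> frontier (rect k u c w z) \<or> q \<in> frontier (rect k c v w z)"
        using \<beta>(2) cut unfolding cut(6) frontier_rect interior_rect by (auto simp: rect_def)
      with cut show ?thesis by blast
    qed
  qed
  moreover have "vertices E \<subseteq> vertices ?E"
  proof
    fix q assume "q \<in> vertices E"
    then obtain u v w z where uv: "u < v" "w < z" "rect k u v w z \<in> E"
      "coord k q \<in> {u, v}" "coord (orth k) q \<in> {w, z}"
      unfolding vertices_rect_iff[of q E k] by blast
    show "q \<in> vertices ?E"
    proof (cases "traverses (seg k c a b) (rect k u v w z)")
      case False
      then have "rect k u v w z \<in> ?E" using uv by (auto simp: cut_elems_def)
      with uv show ?thesis unfolding vertices_rect_iff[of q ?E k] by blast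
    next
      case True
      then have c: "u < c" "c < v" using traverses_rect_imp[OF uv(1,2)] by blast+
      have "rect k u v w z \<inter> {q. coord k q \<le> c} \<in> ?E" "rect k u v w z \<inter> {q. c \<le> coord k q} \<in> ?E"
        using True uv(3) unfolding cut_elems_def by blast+
      then have "rect k u c w z \<in> ?E" "rect k c v w z \<in> ?E"
        using c by (simp_all add: rect_halves)
      with c uv show ?thesis unfolding vertices_rect_iff[of q ?E k] by blast
    qed
  qed
  ultimately show ?thesis using assms(2) unfolding mesh_seg_def by blast
qed

text \<open>The rectangle \<open>R\<close> lies in an old element. If that element is cut, the
  common edge of its halves is a mesh segment of the new mesh spanning the full extent of the
  element, hence of \<open>R\<close>. As it does not cross \<open>R\<close>, it leaves
  \<open>R\<close> on one side, inside one half.\<close>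

lemma cut_elems_uncrossed:
  assumes rects: "\<forall>\<beta>\<in>E. rectangle \<beta>" and unc: "uncrossed_in_element E"
  shows "uncrossed_in_element (cut_elems k c (seg k c a b) E)"
  unfolding uncrossed_in_element_def
proof (intro allI impI, elim conjE)
  let ?E = "cut_elems k c (seg k c a b) E"
  fix R assume R: "rectangle R" "R \<subseteq> \<Union>?E"
    and nc: "\<forall>k c a b. mesh_seg ?E k c a b \<longrightarrow> \<not> crosses k c a b R"
  have "R \<subseteq> \<Union>E"
    using R(2) by (auto simp: cut_elems_def)
  moreover have "\<forall>k c a b. mesh_seg E k c a b \<longrightarrow> \<not> crosses k c a b R"
    using nc mesh_seg_cut_elems[OF rects, where c = c and k = k and a = a and b = b] by blast
  ultimately obtain \<beta> where \<beta>: "\<beta> \<in> E" "R \<subseteq> \<beta>"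
    using unc R(1) unfolding uncrossed_in_element_def by blast
  have "rectangle \<beta>" using rects \<beta> by blast
  then show "\<exists>\<beta>\<in>?E. R \<subseteq> \<beta>" using \<beta>(1)
  proof (cases rule: cut_elems_cases[of \<beta> E k c a b])
    case kept
    with \<beta> show ?thesis by blast
  next
    case (cut u v w z)
    have "seg k c w z \<subseteq> frontier (rect k u c w z)"
      unfolding frontier_rect interior_rect using cut by (auto simp: rect_def mem_seg)
    moreover have "pt k c w \<in> vertices ?E" "pt k c z \<in> vertices ?E"
      unfolding vertices_rect_iff[of _ ?E k] using cut
      by (intro exI[of _ u] exI[of _ c] exI[of _ w] exI[of _ z]; simp)+
    ultimately have "mesh_seg ?E k c w z"
      using cut unfolding mesh_seg_def by blast
    with nc have nc': "\<not> crosses k c w z R" by blast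
    obtain u' v' w' z' where lt: "u' < v'" "w' < z'" and R': "R = rect k u' v' w' z'"
      using rectangleE[OF R(1)] by metis
    have "w \<le> w'" "z' \<le> z"
      using rect_subset_rect[OF lt \<beta>(2)[unfolded R' cut(6)]] by auto
    then have "crosses k c w z R" if "u' < c" "c < v'"
      using that lt(2) unfolding crosses_def R' by blast
    with nc' have "v' \<le> c \<or> c \<le> u'" by force
    then have "R \<subseteq> rect k u c w z \<or> R \<subseteq> rect k c v w z"
      using \<beta>(2) unfolding R' cut(6) by (auto simp: rect_def)
    with cut show ?thesis by blast
  qed
qed

section \<open>Induction along the construction sequence\<close>

lemma LR_sequenceD:
  assumes "LR_sequence p \<tau>\<^sub>1 \<tau>\<^sub>2 Ms N"
  shows "1 \<le> N" "tensor_mesh \<tau>\<^sub>1 \<tau>\<^sub>2 (Ms 1)"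
    and "\<And>i. 1 \<le> i \<Longrightarrow> i \<le> N \<Longrightarrow> box_mesh p (Ms i)"
    and "\<And>i. 1 \<le> i \<Longrightarrow> i < N \<Longrightarrow> \<exists>k \<gamma> m. inserted k \<gamma> m (Ms i) (Ms (Suc i))"
  using assms by (simp_all add: LR_sequence_def)

lemma LR_mesh_box_mesh: "LR_mesh p M \<Longrightarrow> box_mesh p M"
  unfolding LR_mesh_def using LR_sequenceD(1,3) by blast

lemma inserted_elems:
  assumes "inserted k \<gamma> m M M'"
  obtains c a b where "elems M' = cut_elems k c (seg k c a b) (elems M)"
proof -
  have "\<exists>c a b. \<gamma> = seg k c a b \<and> elems M' = cut_elems k c \<gamma> (elems M)"
    using assms unfolding inserted_def by (elim conjE)
  then show thesis using that by blast
qed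

lemma LR_mesh_uncrossed:
  assumes "LR_mesh p M"
  shows "uncrossed_in_element (elems M)"
proof -
  obtain \<tau>\<^sub>1 \<tau>\<^sub>2 Ms N where seq: "LR_sequence p \<tau>\<^sub>1 \<tau>\<^sub>2 Ms N" and M: "M = Ms N"
    using assms unfolding LR_mesh_def by blast
  note seqD = LR_sequenceD[OF seq]
  have "i \<le> N \<longrightarrow> uncrossed_in_element (elems (Ms i))" if "1 \<le> i" for i
    using that
  proof (induction i rule: dec_induct)
    case base
    show ?case using tensor_mesh_uncrossed[OF seqD(2)] by simp
  next
    case (step i)
    show ?case
    proof
      assume i: "Suc i \<le> N"
      then have "box_mesh p (Ms i)"
        using seqD(3) step(1) by simp
      then have rects: "\<forall>\<beta>\<in>elems (Ms i). rectangle \<beta>"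
        unfolding box_mesh_def box_partition_def by blast
      obtain k \<gamma> m where "inserted k \<gamma> m (Ms i) (Ms (Suc i))"
        using seqD(4)[of i] step(1) i by auto
      then obtain c a b where "elems (Ms (Suc i)) = cut_elems k c (seg k c a b) (elems (Ms i))"
        by (rule inserted_elems)
      moreover have "uncrossed_in_element (elems (Ms i))" using step i by simp
      ultimately show "uncrossed_in_element (elems (Ms (Suc i)))"
        using cut_elems_uncrossed[OF rects] by simp
    qed
  qed
  from this[OF seqD(1)] M show ?thesis by simp
qed

section \<open>B-splines of degree zero\<close>

text \<open>Evaluating a vanishing linear combination at the point that isolates \<open>f\<close>
  leaves only the term of \<open>f\<close>, whose coefficient must then be zero.\<close>

lemma independent_if_isolated:
  assumes "\<And>f. f \<in> F \<Longrightarrow> \<exists>q. f q \<noteq> 0 \<and> (\<forall>g\<in>F. g \<noteq> f \<longrightarrow> g q = 0)"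
  shows "fun_space.independent F"
proof
  assume "fun_space.dependent F"
  then obtain U r f where U: "finite U" "U \<subseteq> F" "f \<in> U" "r f \<noteq> 0"
    and sum: "(\<Sum>g\<in>U. fun_scale (r g) g) = 0"
    unfolding fun_space.dependent_explicit by blast
  obtain q where q: "f q \<noteq> 0" "\<forall>g\<in>F. g \<noteq> f \<longrightarrow> g q = 0"
    using assms U by blast
  have eval: "(\<Sum>g\<in>A. fun_scale (r g) g) q = (\<Sum>g\<in>A. r g * g q)" if "finite A" for A
    using that by induction (auto simp: fun_scale_def)
  have "0 = (\<Sum>g\<in>U. r g * g q)"
    using sum eval[OF U(1)] by simp
  also have "\<dots> = (\<Sum>g\<in>{f}. r g * g q)"
    using U q by (intro sum.mono_neutral_right) auto
  finally show False using U q by simp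
qed

lemma tp_bspline_degree_0:
  "tp_bspline (0, 0) ([x1, x2], [y1, y2]) (s, t) =
     indicator {x1..<x2} s * indicator {y1..<y2} t"
  by (simp add: tp_bspline_def)

text \<open>A common superset of the MS and LR families; independence of both follows from
  independence of this one set.\<close>

definition element_bsplines :: "point set set \<Rightarrow> (point \<Rightarrow> real) set" where
  "element_bsplines E =
     {tp_bspline (0, 0) ([x1, x2], [y1, y2]) | x1 x2 y1 y2.
        x1 < x2 \<and> y1 < y2 \<and> {x1..x2} \<times> {y1..y2} \<in> E}"

text \<open>A division only gives disjoint interiors. An open set disjoint from the interior of a
  rectangle is also disjoint from the closure of that interior, which is the full rectangle.\<close>

lemma box_partition_interior_disjoint:
  assumes "box_partition E \<Omega>" "\<beta> \<in> E" "\<beta>' \<in> E" "\<beta> \<noteq> \<beta>'"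
  shows "interior \<beta> \<inter> \<beta>' = {}"
proof -
  have "interior \<beta> \<inter> interior \<beta>' = {}"
    using assms unfolding box_partition_def division_of_def by blast
  then have "interior \<beta> \<inter> closure (interior \<beta>') = {}"
    by (simp add: open_Int_closure_eq_empty)
  moreover have "rectangle \<beta>'"
    using assms unfolding box_partition_def by blast
  then obtain u v w z where "u < v" "w < z" "\<beta>' = rect Vert u v w z"
    by (rule rectangleE)
  ultimately show ?thesis by (simp add: closure_interior_rect)
qed

text \<open>Splits of the mesh consist of boundary points of elements, so they cannot enter the
  interior of an element. This later forces the edges of a support onto those of its
  element.\<close>

lemma box_partition_interior_frontier:
  assumes "box_partition E \<Omega>" "\<beta> \<in> E"
  shows "interior \<beta> \<inter> (\<Union>\<beta>'\<in>E. frontier \<beta>') = {}"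
proof -
  have "interior \<beta> \<inter> frontier \<beta>' = {}" if "\<beta>' \<in> E" for \<beta>'
  proof (cases "\<beta>' = \<beta>")
    case True
    then show ?thesis by (auto simp: frontier_def)
  next
    case False
    have "rectangle \<beta>'"
      using assms that unfolding box_partition_def by blast
    then have "frontier \<beta>' \<subseteq> \<beta>'"
      by (rule rectangleE[of _ Vert]) (auto simp: frontier_rect)
    with box_partition_interior_disjoint[OF assms that] False show ?thesis by blast
  qed
  then show ?thesis by blast
qed

text \<open>The centre of an element lies in no other element, and a degree-zero B-spline vanishes
  off its closed support, so the centre isolates the indicator of its element.\<close>

lemma independent_element_bsplines:
  assumes "box_partition E \<Omega>"
  shows "fun_space.independent (element_bsplines E)"
proof (rule independent_if_isolated)
  fix f assume "f \<in> element_bsplines E"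
  then obtain x1 x2 y1 y2 where f: "f = tp_bspline (0, 0) ([x1, x2], [y1, y2])"
    and lt: "x1 < x2" "y1 < y2" and \<beta>: "{x1..x2} \<times> {y1..y2} \<in> E"
    unfolding element_bsplines_def by blast
  let ?s = "(x1 + x2) / 2" and ?t = "(y1 + y2) / 2"
  have int: "(?s, ?t) \<in> interior ({x1..x2} \<times> {y1..y2})"
    using lt by (auto simp: interior_Times)
  have "g (?s, ?t) = 0" if g_mem: "g \<in> element_bsplines E" and neq: "g \<noteq> f" for g
  proof -
    obtain u1 u2 v1 v2 where g: "g = tp_bspline (0, 0) ([u1, u2], [v1, v2])"
      and lt': "u1 < u2" "v1 < v2" and \<beta>': "{u1..u2} \<times> {v1..v2} \<in> E"
      using g_mem unfolding element_bsplines_def by blast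
    \<comment> \<open>A nondegenerate rectangle determines its four bounds, hence its B-spline, so
      different functions come from different elements.\<close>
    have "{x1..x2} \<times> {y1..y2} \<noteq> {u1..u2} \<times> {v1..v2}"
      using neq lt lt' unfolding f g by (auto simp: times_eq_iff Icc_eq_Icc)
    from box_partition_interior_disjoint[OF assms \<beta> \<beta>' this] int
    have "(?s, ?t) \<notin> {u1..u2} \<times> {v1..v2}" by blast
    then show ?thesis by (auto simp: g tp_bspline_degree_0 indicator_def)
  qed
  moreover have "f (?s, ?t) \<noteq> 0"
    using lt by (auto simp: f tp_bspline_degree_0 indicator_def)
  ultimately show "\<exists>q. f q \<noteq> 0 \<and> (\<forall>g\<in>element_bsplines E. g \<noteq> f \<longrightarrow> g q = 0)" by blast
qed

section \<open>Minimal supports in degree zero are elements\<close>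

lemma list_length_2E:
  assumes "length xs = 2"
  obtains a b where "xs = [a, b]"
  using assms by (auto simp: length_Suc_conv numeral_2_eq_2)

lemma minimal_support_degree_0:
  assumes M: "LR_mesh (0, 0) M" and ok: "knots_ok (0, 0) B" and min: "minimal_support M B"
  shows "tp_bspline (0, 0) B \<in> element_bsplines (elems M)"
proof -
  have box: "box_mesh (0, 0) M" by (rule LR_mesh_box_mesh[OF M])
  then obtain \<Omega> where part: "box_partition (elems M) \<Omega>"
    unfolding box_mesh_def by blast
  then have fin: "finite (elems M)"
    unfolding box_partition_def by (auto dest: division_ofD(1))
  have "length (fst B) = 2" "length (snd B) = 2"
    using ok by (simp_all add: knots_ok_def)
  then obtain x1 x2 y1 y2 where "fst B = [x1, x2]" "snd B = [y1, y2]"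
    by (metis list_length_2E)
  then have B: "B = ([x1, x2], [y1, y2])" by (simp add: prod_eq_iff)
  have le: "x1 \<le> x2" "y1 \<le> y2" using ok by (auto simp: knots_ok_def B)
  have sub: "supp B \<subseteq> \<Union>(elems M)"
    and splits: "\<And>\<sigma> m. (\<sigma>, m) \<in> bspline_splits B \<Longrightarrow>
                  \<exists>k \<gamma>. mesh_split k M \<gamma> \<and> \<sigma> \<subseteq> \<gamma> \<and> m \<le> split_mult M \<gamma>"
    using min unfolding minimal_support_def has_support_def by blast+
  have split_facts: "m \<le> 1" "\<sigma> \<subseteq> (\<Union>\<beta>\<in>elems M. frontier \<beta>)" if "(\<sigma>, m) \<in> bspline_splits B" for \<sigma> m
    using splits[OF that] split_mult_degree_0[OF box] mesh_split_subset_frontier by fastforce+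
  have bs: "(seg Vert x1 y1 y2, count_list [x1, x2] x1) \<in> bspline_splits B"
    "(seg Vert x2 y1 y2, count_list [x1, x2] x2) \<in> bspline_splits B"
    "(seg Horiz y1 x1 x2, count_list [y1, y2] y1) \<in> bspline_splits B"
    "(seg Horiz y2 x1 x2, count_list [y1, y2] y2) \<in> bspline_splits B"
    unfolding bspline_splits_def B by auto
  \<comment> \<open>Two equal knots would form a split of multiplicity 2, while every split of the
    mesh has multiplicity 1.\<close>
  have lt: "x1 < x2" "y1 < y2"
    using split_facts(1)[OF bs(1)] split_facts(1)[OF bs(3)] le by (auto split: if_splits)
  have S: "supp B = {x1..x2} \<times> {y1..y2}" by (simp add: supp_def B)
  \<comment> \<open>By minimality a crossing segment would contain a split of the B-spline. With two
    knots in each direction these splits are just the edges of the support, so the segment would run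
    along an edge and miss the interior.\<close>
  have "\<not> crosses k c a b (supp B)" if "mesh_seg (elems M) k c a b" for k c a b
  proof
    assume cr: "crosses k c a b (supp B)"
    have "mesh_split k M (seg k c a b)"
      by (rule mesh_seg_imp_mesh_split[OF fin that])
    with crosses_disconnects_interior[OF cr] min
    obtain \<sigma> m where \<sigma>: "(\<sigma>, m) \<in> bspline_splits B" "\<sigma> \<subseteq> seg k c a b"
      unfolding minimal_support_def traverses_bspline_def by blast
    obtain q where q: "q \<in> seg k c a b" "q \<in> interior (supp B)"
      using crosses_disconnects_interior(2)[OF cr] by blast
    from \<sigma>(1) consider c' where "\<sigma> = seg Vert c' y1 y2" "c' \<in> {x1, x2}"
      | c' where "\<sigma> = seg Horiz c' x1 x2" "c' \<in> {y1, y2}"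
      unfolding bspline_splits_def B by auto
    then show False
    proof cases
      case 1
      \<comment> \<open>Both end points of the edge lie on the segment; this fixes its direction and
        its constant coordinate.\<close>
      then have "(c', y1) \<in> seg k c a b" "(c', y2) \<in> seg k c a b"
        using \<sigma>(2) lt by (auto simp: seg_def)
      with q 1 lt show False
        unfolding S by (cases k) (auto simp: mem_seg interior_Times)
    next
      case 2
      then have "(x1, c') \<in> seg k c a b" "(x2, c') \<in> seg k c a b"
        using \<sigma>(2) lt by (auto simp: seg_def)
      with q 2 lt show False
        unfolding S by (cases k) (auto simp: mem_seg interior_Times)
    qed
  qed
  moreover have "rectangle (supp B)"
    using lt unfolding S rectangle_def by blast
  ultimately obtain \<beta> where \<beta>: "\<beta> \<in> elems M" "supp B \<subseteq> \<beta>"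
    using LR_mesh_uncrossed[OF M] sub unfolding uncrossed_in_element_def by blast
  have "rectangle \<beta>" using part \<beta> unfolding box_partition_def by blast
  then obtain u1 u2 v1 v2 where \<beta>_eq: "\<beta> = rect Vert u1 u2 v1 v2"
    by (rule rectangleE)
  have in\<beta>: "u1 \<le> x1" "x2 \<le> u2" "v1 \<le> y1" "y2 \<le> v2"
    using rect_subset_rect[OF lt, of Vert] \<beta>(2) unfolding \<beta>_eq S rect_Vert by blast+
  have avoid: "q \<notin> interior \<beta>" if "q \<in> \<sigma>" "(\<sigma>, m) \<in> bspline_splits B" for q \<sigma> m
    using box_partition_interior_frontier[OF part \<beta>(1)] split_facts(2)[OF that(2)] that(1) by blast
  \<comment> \<open>At the midpoint of an edge the coordinate along the edge is strictly inside
    \<open>\<beta>\<close>. Since the midpoint is not interior to \<open>\<beta>\<close>, the other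
    coordinate must be a bound of \<open>\<beta>\<close>.\<close>
  have mids: "(x1, (y1 + y2) / 2) \<in> seg Vert x1 y1 y2" "(x2, (y1 + y2) / 2) \<in> seg Vert x2 y1 y2"
    "((x1 + x2) / 2, y1) \<in> seg Horiz y1 x1 x2" "((x1 + x2) / 2, y2) \<in> seg Horiz y2 x1 x2"
    using lt by (auto simp: mem_seg)
  have "u1 = x1" "u2 = x2" "v1 = y1" "v2 = y2"
    using avoid[OF mids(1) bs(1)] avoid[OF mids(2) bs(2)] avoid[OF mids(3) bs(3)]
      avoid[OF mids(4) bs(4)] lt in\<beta>
    unfolding \<beta>_eq interior_rect by auto
  with \<beta>(1) lt show ?thesis
    unfolding element_bsplines_def B \<beta>_eq rect_Vert by blast
qed

section \<open>LR B-splines\<close>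

lemma sorted_concat_replicate:
  "sorted xs \<Longrightarrow> sorted (concat (map (\<lambda>c. replicate (f c) c) xs))"
  by (induction xs) (auto simp: sorted_append)

lemma sorted_sublist: "sublist xs ys \<Longrightarrow> sorted ys \<Longrightarrow> sorted xs"
  by (auto simp: sublist_def sorted_append)

lemma knots_ok_tensor_bsplines:
  assumes "tensor_mesh \<tau>\<^sub>1 \<tau>\<^sub>2 M" "B \<in> tensor_bsplines p \<tau>\<^sub>1 \<tau>\<^sub>2 M"
  shows "knots_ok p B"
proof -
  have "sorted \<tau>\<^sub>1" "sorted \<tau>\<^sub>2"
    using assms(1) by (simp_all add: tensor_mesh_def strict_sorted_imp_sorted)
  then show ?thesis
    using assms(2) unfolding tensor_bsplines_def knots_ok_def
    by (auto elim!: sorted_sublist intro!: sorted_concat_replicate)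
qed

lemma knots_ok_refine:
  assumes "knots_ok p B"
  shows "knots_ok p (refine_left k c B)" "knots_ok p (refine_right k c B)"
proof -
  have "sorted (butlast (insort c xs))" "sorted (tl (insort c xs))" if "sorted xs" for xs :: "real list"
    using that by (auto simp: sorted_butlast sorted_tl sorted_insort)
  then show "knots_ok p (refine_left k c B)" "knots_ok p (refine_right k c B)"
    using assms by (cases k; auto simp: knots_ok_def)+
qed

lemma knots_ok_knot_insertions:
  assumes "(knot_insertion M)\<^sup>*\<^sup>* \<B> \<B>'" "\<forall>B\<in>\<B>. knots_ok p B"
  shows "\<forall>B\<in>\<B>'. knots_ok p B"
  using assms by (induction rule: rtranclp_induct) (auto simp: knot_insertion_def knots_ok_refine)

text \<open>\<open>minimal_support\<close> does not constrain the length or order of the knot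
  vectors, so these are carried along the run from the tensor product B-splines through every knot
  insertion.\<close>

lemma LR_run_knots_ok:
  assumes "LR_run p \<tau>\<^sub>1 \<tau>\<^sub>2 Ms N Bs" "1 \<le> i" "i \<le> N"
  shows "\<forall>B\<in>Bs i. knots_ok p B"
  using assms(2,3)
proof (induction i rule: dec_induct)
  case base
  then show ?case
    using assms(1) knots_ok_tensor_bsplines unfolding LR_run_def LR_sequence_def by blast
next
  case (step i)
  then have "(knot_insertion (Ms (Suc i)))\<^sup>*\<^sup>* (Bs i) (Bs (Suc i))"
    using assms(1) unfolding LR_run_def by auto
  with step show ?case using knots_ok_knot_insertions by auto
qed

section \<open>Tensor product B-splines of the initial mesh\<close>

lemma concat_replicate_1:
  assumes "\<And>c. c \<in> set xs \<Longrightarrow> f c = (1::nat)"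
  shows "concat (map (\<lambda>c. replicate (f c) c) xs) = xs"
  using assms by (induction xs) auto

lemma sublist_length_2E:
  assumes "sublist xs ys" "length xs = 2"
  obtains i where "Suc i < length ys" "xs = [ys ! i, ys ! Suc i]"
proof -
  obtain a b where xs: "xs = [a, b]" using assms(2) by (rule list_length_2E)
  obtain us vs where "ys = us @ xs @ vs" using assms(1) unfolding sublist_def by blast
  then show thesis by (intro that[of "length us"]) (auto simp: xs nth_append)
qed

text \<open>For runs without insertions, where \<open>LR_run\<close> does not demand minimal
  support. All grid lines have multiplicity 1, so the knot vectors of the mesh are the two sequences
  themselves, and consecutive knots bound a cell.\<close>

lemma tensor_bsplines_degree_0:
  assumes T: "tensor_mesh \<tau>\<^sub>1 \<tau>\<^sub>2 M" and box: "box_mesh (0, 0) M"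
    and B: "B \<in> tensor_bsplines (0, 0) \<tau>\<^sub>1 \<tau>\<^sub>2 M"
  shows "tp_bspline (0, 0) B \<in> element_bsplines (elems M)"
proof -
  have fin: "finite (elems M)"
    using box unfolding box_mesh_def box_partition_def by (auto dest: division_ofD(1))
  have sorted: "sorted_wrt (<) \<tau>\<^sub>1" "sorted_wrt (<) \<tau>\<^sub>2" and "\<tau>\<^sub>1 \<noteq> []" "\<tau>\<^sub>2 \<noteq> []"
    using T unfolding tensor_mesh_def by auto
  then have ends: "\<tau>\<^sub>1 ! 0 = hd \<tau>\<^sub>1" "\<tau>\<^sub>1 ! (length \<tau>\<^sub>1 - 1) = last \<tau>\<^sub>1"
    "\<tau>\<^sub>2 ! 0 = hd \<tau>\<^sub>2" "\<tau>\<^sub>2 ! (length \<tau>\<^sub>2 - 1) = last \<tau>\<^sub>2"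
    by (simp_all add: hd_conv_nth last_conv_nth)
  have m: "split_mult M (seg Vert c (hd \<tau>\<^sub>2) (last \<tau>\<^sub>2)) = 1" if "c \<in> set \<tau>\<^sub>1" for c
    using that tensor_mesh_line_mesh_seg(1)[OF T] unfolding ends in_set_conv_nth
    by (metis split_mult_degree_0[OF box] mesh_seg_imp_mesh_split[OF fin])
  have m': "split_mult M (seg Horiz c (hd \<tau>\<^sub>1) (last \<tau>\<^sub>1)) = 1" if "c \<in> set \<tau>\<^sub>2" for c
    using that tensor_mesh_line_mesh_seg(2)[OF T] unfolding ends in_set_conv_nth
    by (metis split_mult_degree_0[OF box] mesh_seg_imp_mesh_split[OF fin])
  obtain x y where xy: "B = (x, y)" "length x = 2" "length y = 2" "sublist x \<tau>\<^sub>1" "sublist y \<tau>\<^sub>2"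
    using B unfolding tensor_bsplines_def by (auto simp: concat_replicate_1 m m')
  obtain i where i: "Suc i < length \<tau>\<^sub>1" "x = [\<tau>\<^sub>1 ! i, \<tau>\<^sub>1 ! Suc i]"
    using xy(4,2) by (rule sublist_length_2E)
  obtain j where j: "Suc j < length \<tau>\<^sub>2" "y = [\<tau>\<^sub>2 ! j, \<tau>\<^sub>2 ! Suc j]"
    using xy(5,3) by (rule sublist_length_2E)
  have "\<tau>\<^sub>1 ! i < \<tau>\<^sub>1 ! Suc i" "\<tau>\<^sub>2 ! j < \<tau>\<^sub>2 ! Suc j"
    using sorted i j by (auto intro: sorted_wrt_nth_less)
  moreover have "{\<tau>\<^sub>1 ! i..\<tau>\<^sub>1 ! Suc i} \<times> {\<tau>\<^sub>2 ! j..\<tau>\<^sub>2 ! Suc j} \<in> elems M"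
    using T i j unfolding tensor_mesh_def by blast
  ultimately show ?thesis
    unfolding element_bsplines_def xy(1) i(2) j(2) by blast
qed

lemma LR_bsplines_degree_0:
  assumes "is_LR_bsplines (0, 0) M F"
  shows "F \<subseteq> element_bsplines (elems M)"
proof -
  obtain \<tau>\<^sub>1 \<tau>\<^sub>2 Ms N Bs where run: "LR_run (0, 0) \<tau>\<^sub>1 \<tau>\<^sub>2 Ms N Bs" and M: "M = Ms N"
    and F: "F = tp_bspline (0, 0) ` Bs N"
    using assms unfolding is_LR_bsplines_def by blast
  have seq: "LR_sequence (0, 0) \<tau>\<^sub>1 \<tau>\<^sub>2 Ms N"
    using run unfolding LR_run_def by blast
  then have LR: "LR_mesh (0, 0) M" and N: "1 \<le> N"
    unfolding LR_mesh_def M LR_sequence_def by blast+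
  have "tp_bspline (0, 0) B \<in> element_bsplines (elems M)" if B: "B \<in> Bs N" for B
  proof (cases "N = 1")
    case True
    then have "B \<in> tensor_bsplines (0, 0) \<tau>\<^sub>1 \<tau>\<^sub>2 M" "tensor_mesh \<tau>\<^sub>1 \<tau>\<^sub>2 M"
      using run seq B unfolding LR_run_def LR_sequence_def M by auto
    then show ?thesis
      using tensor_bsplines_degree_0 LR_mesh_box_mesh[OF LR] by blast
  next
    case False
    \<comment> \<open>\<open>LR_run\<close> states minimality at stage \<open>Suc i\<close> for
      \<open>i\<close> from 1 on, so the last stage is reached through its predecessor.\<close>
    then obtain n where n: "N = Suc n" "n \<in> {1..<N}"
      using N by (cases N) auto
    then have "minimal_support M B"
      using run B unfolding LR_run_def M by blast
    moreover have "knots_ok (0, 0) B"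
      using LR_run_knots_ok[OF run N] B by blast
    ultimately show ?thesis
      using minimal_support_degree_0[OF LR] by blast
  qed
  then show ?thesis unfolding F by blast
qed

theorem mainTheorem4:
  fixes p :: "nat \<times> nat" and M :: mesh
  assumes "p = (0, 0)" and "LR_mesh p M"
  shows "fun_space.independent (MS_bsplines p M) \<and>
         (\<forall>F. is_LR_bsplines p M F \<longrightarrow> fun_space.independent F)"
proof -
  have LR: "LR_mesh (0, 0) M" using assms by simp
  then obtain \<Omega> where "box_partition (elems M) \<Omega>"
    using LR_mesh_box_mesh unfolding box_mesh_def by blast
  then have indep: "fun_space.independent (element_bsplines (elems M))"
    by (rule independent_element_bsplines)
  have "MS_bsplines (0, 0) M \<subseteq> element_bsplines (elems M)"
    unfolding MS_bsplines_def using minimal_support_degree_0[OF LR] by blast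
  then show ?thesis
    using fun_space.independent_mono[OF indep] LR_bsplines_degree_0 assms(1) by blast
qed

end
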